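(* For every $\alpha\in[\frac{1}{3},1)$, every $x\in\mathbb{C}$ with $|x|=1$, and every natural number $n\geq 1$, $$|A_{2n-1}(\alpha,x)|\leq A_{2n-1}(\alpha,1).$$
   Context: For $\alpha>0$ and $x\in\mathbb{C}$ with $|x|=1$, the numbers $A_m(\alpha,x)$ are the coefficients of the Maclaurin expansion $$\frac{(1+xz)^\alpha}{1-z}=\sum_{m=0}^\infty A_m(\alpha,x)z^m,\qquad |z|<1,$$ where the power is the principal branch. Equivalently, $A_m(\alpha,x)=\sum_{k=0}^{m}\frac{(-\alpha)_k(-x)^k}{k!}$, where $(a)_0=1$ and $(a)_k=a(a+1)\cdots(a+k-1)$ for $k\ge 1$. In particular $A_m(\alpha,1)$ is real. *)

theory Defs
  imports "HOL-Complex_Analysis.Complex_Analysis"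
begin

definition A_coeff :: "nat \<Rightarrow> real \<Rightarrow> complex \<Rightarrow> complex" where
  "A_coeff m \<alpha> x =
     fps_nth (fps_expansion (\<lambda>z. (1 + x * z) powr (of_real \<alpha>) / (1 - z)) 0) m"

lemma A_coeff_sums:
  assumes "norm x = 1" "norm z < 1"
  shows "(\<lambda>m. A_coeff m \<alpha> x * z ^ m) sums ((1 + x * z) powr (of_real \<alpha>) / (1 - z))"
proof -
  have *: "1 + x * w \<notin> \<real>\<^sub>\<le>\<^sub>0" if "norm w < 1" for w
  proof
    assume "1 + x * w \<in> \<real>\<^sub>\<le>\<^sub>0"
    then have "Re (x * w) \<le> -1"
      by (auto simp: complex_nonpos_Reals_iff)
    moreover have "\<bar>Re (x * w)\<bar> \<le> norm (x * w)"
      by (rule abs_Re_le_cmod)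
    ultimately show False
      using that assms(1) by (simp add: norm_mult)
  qed
  have "(\<lambda>z. (1 + x * z) powr (of_real \<alpha>) / (1 - z)) holomorphic_on ball 0 1"
    using * by (intro holomorphic_intros) auto
  from holomorphic_power_series[OF this, of z] assms(2) show ?thesis
    by (simp add: A_coeff_def fps_expansion_def)
qed

lemma A_coeff_eq_sum:
  assumes "norm x = 1"
  shows "A_coeff m \<alpha> x = (\<Sum>k\<le>m. pochhammer (- of_real \<alpha>) k * (- x) ^ k / fact k)"
proof -
  define f where "f = (\<lambda>z. (1 + x * z) powr (of_real \<alpha>))"
  define F where "F = Abs_fps (\<lambda>k. (of_real \<alpha> gchoose k) * x ^ k)"
  have F: "f has_fps_expansion F"
  proof (rule has_fps_expansionI)
    have "\<forall>\<^sub>F u in nhds 0. u \<in> ball (0::complex) 1"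
      by (intro eventually_nhds_in_open) auto
    then show "\<forall>\<^sub>F u in nhds 0. (\<lambda>n. fps_nth F n * u ^ n) sums f u"
    proof eventually_elim
      case (elim u)
      then show ?case
        using gen_binomial_complex[of "x * u" "of_real \<alpha>"] assms
        by (simp add: F_def f_def norm_mult power_mult_distrib mult_ac)
    qed
  qed
  have G: "(\<lambda>z. 1 / (1 - z)) has_fps_expansion Abs_fps (\<lambda>_. 1 :: complex)"
  proof (rule has_fps_expansionI)
    have "\<forall>\<^sub>F u in nhds 0. u \<in> ball (0::complex) 1"
      by (intro eventually_nhds_in_open) auto
    then show "\<forall>\<^sub>F u in nhds 0. (\<lambda>n. fps_nth (Abs_fps (\<lambda>_. 1)) n * u ^ n) sums (1 / (1 - u :: complex))"
      by eventually_elim (use geometric_sums in auto)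
  qed
  have "(\<lambda>z. f z * (1 / (1 - z))) has_fps_expansion F * Abs_fps (\<lambda>_. 1)"
    by (intro has_fps_expansion_mult F G)
  from fps_nth_fps_expansion[OF this, of m]
  have "A_coeff m \<alpha> x = fps_nth (F * Abs_fps (\<lambda>_. 1)) m"
    by (simp add: A_coeff_def fps_expansion_def f_def)
  also have "\<dots> = (\<Sum>k\<le>m. (of_real \<alpha> gchoose k) * x ^ k)"
    by (simp add: fps_mult_nth F_def atLeast0AtMost)
  also have "\<dots> = (\<Sum>k\<le>m. pochhammer (- of_real \<alpha>) k * (- x) ^ k / fact k)"
    by (intro sum.cong refl) (simp add: gbinomial_pochhammer power_minus[of x] mult_ac)
  finally show ?thesis .
qed

lemma A_coeff_1_real: "A_coeff m \<alpha> 1 \<in> \<real>"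
proof -
  have "A_coeff m \<alpha> 1 = of_real (\<Sum>k\<le>m. pochhammer (- \<alpha>) k * (- 1) ^ k / fact k)"
    by (simp add: A_coeff_eq_sum flip: pochhammer_of_real)
  then show ?thesis
    by (metis Reals_of_real)
qed

end

theory Submission
  imports Defs "HOL-Probability.Probability"
begin

text \<open>
  The coefficients of \<open>(1 + z)\<^sup>\<alpha>\<close> are, up to alternating signs, differences of consecutive moments of
  the Beta distribution with parameters \<open>1 - \<alpha>\<close> and \<open>\<alpha>\<close>. Hence, for odd \<open>m\<close>, the partial sum
  \<open>A\<^sub>m(\<alpha>, x)\<close> is \<open>(1 + x)\<^sup>\<alpha>\<close> plus the integral of \<open>x\<^bsup>m+1\<^esup> t\<^sup>m (1 - t) / (1 + x t)\<close> against this
  distribution. Put \<open>u = \<bar>1 + x\<bar>\<close> and take \<open>m \<ge> 3\<close>. If \<open>u \<ge> 1/3\<close>, then \<open>2\<^sup>\<alpha> - u\<^sup>\<alpha>\<close> is an integral against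
  the same distribution, and the triangle inequality reduces the claim to a pointwise inequality of
  integrands. If \<open>u \<le> 1/3\<close>, then already \<open>u\<^sup>\<alpha>\<close> plus the third moment is below \<open>2\<^sup>\<alpha>\<close>; this is where
  \<open>\<alpha> \<ge> 1/3\<close> is used.
\<close>

section \<open>Moments of the Beta distribution and binomial coefficients\<close>

text \<open>Closed form of the \<open>k\<close>-th moment of the Beta distribution with parameters
  \<open>1 - \<alpha>\<close> and \<open>\<alpha>\<close>; see
  \<open>has_integral_beta_moment\<close>.\<close>

definition beta_moment :: "real \<Rightarrow> nat \<Rightarrow> real" where
  "beta_moment \<alpha> k = pochhammer (1 - \<alpha>) k / fact k"

lemma beta_moment_nonneg: "\<alpha> < 1 \<Longrightarrow> 0 \<le> beta_moment \<alpha> k"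
  by (simp add: beta_moment_def pochhammer_nonneg)

text \<open>Up to sign, both sides are \<open>\<alpha> / (k + 1)\<close> times the
  \<open>k\<close>-th moment. As an integral, the difference of moments has integrand
  \<open>t ^ k * (1 - t)\<close>, so the binomial series becomes geometric under the integral
  sign.\<close>

lemma gbinomial_Suc_beta_moment:
  "(\<alpha> gchoose Suc k) = (- 1) ^ k * (beta_moment \<alpha> k - beta_moment \<alpha> (Suc k))"
proof -
  have "pochhammer (- \<alpha>) (Suc k) = - \<alpha> * pochhammer (1 - \<alpha>) k"
    by (simp add: pochhammer_rec add.commute)
  then have "(\<alpha> gchoose Suc k) = (- 1) ^ k * (\<alpha> * pochhammer (1 - \<alpha>) k) / fact (Suc k)"
    by (simp add: gbinomial_pochhammer)
  moreover have "\<alpha> * pochhammer (1 - \<alpha>) k / fact (Suc k) = beta_moment \<alpha> k - beta_moment \<alpha> (Suc k)"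
  proof -
    have "beta_moment \<alpha> (Suc k) = (1 - \<alpha> + real k) / (1 + real k) * beta_moment \<alpha> k"
      by (simp add: beta_moment_def pochhammer_Suc)
    then have "beta_moment \<alpha> k - beta_moment \<alpha> (Suc k) = \<alpha> / (1 + real k) * beta_moment \<alpha> k"
      by (simp add: field_simps)
    then show ?thesis
      by (simp add: beta_moment_def)
  qed
  ultimately show ?thesis
    by (metis times_divide_eq_right)
qed

text \<open>The quotient of \<open>Beta (1 - \<alpha> + k) \<alpha>\<close> by
  \<open>Beta (1 - \<alpha>) \<alpha>\<close> simplifies by the functional equation of Gamma, since
  the parameters add up to \<open>1 + k\<close> and to \<open>1\<close>.\<close>

lemma has_integral_beta_moment:
  assumes "0 < \<alpha>" "\<alpha> < 1"
  shows "((\<lambda>t. t powr (- \<alpha>) * (1 - t) powr (\<alpha> - 1) / Beta (1 - \<alpha>) \<alpha> * t ^ k)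
    has_integral beta_moment \<alpha> k) {0<..<1}"
proof -
  have "((\<lambda>t. t powr (1 - \<alpha> + k - 1) * (1 - t) powr (\<alpha> - 1))
    has_integral Beta (1 - \<alpha> + k) \<alpha>) {0<..<1}"
    using has_integral_Beta_real[of "1 - \<alpha> + k" \<alpha>] assms
    by (simp add: has_integral_Icc_iff_Ioo)
  then have "((\<lambda>t. t powr (1 - \<alpha> + k - 1) * (1 - t) powr (\<alpha> - 1) * (1 / Beta (1 - \<alpha>) \<alpha>))
    has_integral Beta (1 - \<alpha> + k) \<alpha> * (1 / Beta (1 - \<alpha>) \<alpha>)) {0<..<1}"
    by (rule has_integral_mult_left)
  moreover have "Beta (1 - \<alpha> + k) \<alpha> * (1 / Beta (1 - \<alpha>) \<alpha>) = beta_moment \<alpha> k"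
  proof -
    have "Gamma \<alpha> > 0" "Gamma (1 - \<alpha>) > 0"
      using assms by (auto intro!: Gamma_real_pos)
    moreover have "1 - \<alpha> \<notin> \<int>\<^sub>\<le>\<^sub>0"
      using assms nonpos_Ints_nonpos[of "1 - \<alpha>"] by auto
    moreover have "1 - \<alpha> + real k + \<alpha> = 1 + real k"
      by simp
    ultimately show ?thesis
      by (simp add: beta_moment_def Beta_def pochhammer_Gamma Gamma_fact)
  qed
  moreover have "t powr (1 - \<alpha> + k - 1) * (1 - t) powr (\<alpha> - 1) * (1 / Beta (1 - \<alpha>) \<alpha>)
      = t powr (- \<alpha>) * (1 - t) powr (\<alpha> - 1) / Beta (1 - \<alpha>) \<alpha> * t ^ k"
    if "t \<in> {0<..<1}" for t
  proof -
    have "t powr (1 - \<alpha> + k - 1) = t powr (- \<alpha>) * t ^ k"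
      using that powr_add[of t "-\<alpha>" "real k"] by (simp add: powr_realpow)
    then show ?thesis by simp
  qed
  ultimately show ?thesis
    by (metis (no_types, lifting) has_integral_cong)
qed

section \<open>Pointwise inequalities\<close>

text \<open>Both squared moduli are affine in \<open>Re x\<close>. Eliminating it shows that the
  modulus on the left depends on \<open>x\<close> only through \<open>norm (1 + x)\<close>.\<close>

lemma norm_1_plus_mult_unit:
  fixes x :: complex
  assumes "norm x = 1"
  shows "norm (1 + x * of_real t) ^ 2 = (1 - t) ^ 2 + t * norm (1 + x) ^ 2"
proof -
  have "Re x ^ 2 + Im x ^ 2 = 1"
    using assms by (simp add: cmod_def)
  then show ?thesis
    unfolding cmod_power2 by (simp, algebra)
qed

text \<open>The right side minus the left has the factor \<open>1 - t\<close>. The cofactor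
  \<open>a * u ^ 2 + b * u + 1 - t - 2 * t ^ 4\<close>, with \<open>a\<close> and \<open>b\<close>
  nonnegative, grows with \<open>u\<close>, so \<open>u = 1 / 3\<close> is the worst case.\<close>

lemma polynomial_bound:
  fixes t u :: real
  assumes t: "0 \<le> t" "t \<le> 1" and u: "1 / 3 \<le> u"
  shows "t ^ 4 * (2 + u) * (1 + (u - 1) * t) \<le> t * u * (1 + t) + ((1 - t) ^ 2 + t * u ^ 2)"
proof -
  define a b where "a = t * (1 + t) * (1 + t ^ 2)" and "b = t * (1 + t) * (1 + t + t ^ 2)"
  have "0 \<le> a" "0 \<le> b"
    using t by (auto simp: a_def b_def)
  have pow: "t ^ 4 \<le> t ^ 2" "t ^ 4 \<le> t ^ 3"
    using t by (auto intro: power_decreasing)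
  \<comment> \<open>Nine times the cofactor at \<open>u = 1 / 3\<close>.\<close>
  have "0 \<le> 9 - 5 * t + 7 * t ^ 2 + 7 * t ^ 3 - 14 * t ^ 4"
    using t pow by simp
  also have "\<dots> = 9 * (a / 9 + b / 3 + 1 - t - 2 * t ^ 4)"
    by (simp add: a_def b_def field_simps power2_eq_square power3_eq_cube power4_eq_xxxx)
  also have "a / 9 \<le> a * u ^ 2"
    using power_mono[OF u, of 2] mult_left_mono[OF _ \<open>0 \<le> a\<close>, of "1 / 9" "u ^ 2"]
    by (simp add: power2_eq_square)
  also have "b / 3 \<le> b * u"
    using mult_left_mono[OF u \<open>0 \<le> b\<close>] by simp
  finally have "0 \<le> a * u ^ 2 + b * u + 1 - t - 2 * t ^ 4"
    by simp
  then have "0 \<le> (1 - t) * (a * u ^ 2 + b * u + 1 - t - 2 * t ^ 4)"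
    using t by (intro mult_nonneg_nonneg) auto
  also have "\<dots> = t * u * (1 + t) + ((1 - t) ^ 2 + t * u ^ 2) - t ^ 4 * (2 + u) * (1 + (u - 1) * t)"
    unfolding a_def b_def by algebra
  finally show ?thesis by simp
qed

text \<open>For \<open>m = 1\<close> this fails near \<open>t = 1\<close> when \<open>u < 1/2\<close>.\<close>

lemma integrand_bound:
  fixes t u d :: real
  assumes t: "0 \<le> t" "t < 1" and u: "1 / 3 \<le> u" "u \<le> 2"
    and d: "0 < d" "d ^ 2 = (1 - t) ^ 2 + t * u ^ 2" and m: "3 \<le> m"
  shows "(u - 1) * (1 - t) / (1 + (u - 1) * t) + t ^ m * ((1 - t) / d)
    \<le> (1 - t) / (1 + t) + t ^ m * ((1 - t) / (1 + t))"
proof -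
  define v where "v = 1 + (u - 1) * t"
  have "v = (1 - t) + u * t"
    by (simp add: v_def algebra_simps)
  then have v: "v > 0"
    using t u by (simp add: add_pos_nonneg)
  have "t ^ 2 \<le> t"
    using t by (simp add: power2_eq_square mult_left_le)
  then have "(t * u) ^ 2 \<le> d ^ 2"
    unfolding d power_mult_distrib
    by (smt (verit) mult_right_mono zero_le_power2)
  then have tu: "t * u \<le> d"
    using d by (meson power2_le_imp_le less_imp_le)
  have "u ^ 2 \<le> 2 ^ 2"
    using u by (intro power_mono) auto
  then have "t * u ^ 2 \<le> t * 4"
    using t by (intro mult_left_mono) auto
  then have "d ^ 2 \<le> (1 + t) ^ 2"
    unfolding d power2_sum power2_diff by simp
  then have d_le: "d \<le> 1 + t"
    by (rule power2_le_imp_le) (use t in simp)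
  \<comment> \<open>Replacing \<open>t * u\<close> by \<open>d\<close> turns the right side into
    \<open>d * (1 + t + d)\<close>. As \<open>(1 + t) ^ 2 - d ^ 2 = t * (4 - u ^ 2)\<close>,
    multiplying by \<open>2 - u\<close> produces the factor \<open>1 + t + d\<close> on the left
    too, and it cancels.\<close>
  have "t ^ 4 * (2 + u) * v \<le> t * u * (1 + t) + d ^ 2"
    using polynomial_bound[of t u] t u by (simp add: v_def d)
  also have "\<dots> \<le> d * (1 + t) + d ^ 2"
    using tu t by (intro add_mono mult_right_mono) auto
  finally have "t ^ 4 * (2 + u) * v * (2 - u) \<le> (d * (1 + t) + d ^ 2) * (2 - u)"
    using u by (intro mult_right_mono) auto
  moreover have "t ^ 4 * (2 + u) * v * (2 - u) = t ^ 3 * (1 + t - d) * v * (1 + t + d)"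
    using d(2) by algebra
  moreover have "(d * (1 + t) + d ^ 2) * (2 - u) = (2 - u) * d * (1 + t + d)"
    by algebra
  ultimately have "t ^ 3 * (1 + t - d) * v * (1 + t + d) \<le> (2 - u) * d * (1 + t + d)"
    by (simp only:)
  then have key: "t ^ 3 * (1 + t - d) * v \<le> (2 - u) * d"
    by (rule mult_right_le_imp_le) (use t d in simp)
  \<comment> \<open>The difference of reciprocals is nonnegative because
    \<open>d \<le> 1 + t\<close>, so \<open>m = 3\<close> is the worst case.\<close>
  have "t ^ m * (1 / d - 1 / (1 + t)) \<le> t ^ 3 * (1 / d - 1 / (1 + t))"
    using t d d_le m by (intro mult_right_mono power_decreasing) (auto simp: frac_le)
  also have "\<dots> = t ^ 3 * (1 + t - d) * v / (d * (1 + t) * v)"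
  proof -
    have "1 / d - 1 / (1 + t) = (1 + t - d) / (d * (1 + t))"
      using d(1) t by (simp add: divide_simps)
    then show ?thesis
      using v by simp
  qed
  also have "\<dots> \<le> (2 - u) * d / (d * (1 + t) * v)"
    using d t v by (intro divide_right_mono key) auto
  also have "\<dots> = 1 / (1 + t) - (u - 1) / v"
  proof -
    have "(2 - u) = v - (u - 1) * (1 + t)"
      by (simp add: v_def algebra_simps)
    then show ?thesis
      using d t v by (simp add: divide_simps)
  qed
  finally have "(1 - t) * (t ^ m * (1 / d - 1 / (1 + t))) \<le> (1 - t) * (1 / (1 + t) - (u - 1) / v)"
    using t by (intro mult_left_mono) auto
  then show ?thesis
    by (simp add: v_def algebra_simps)
qed

section \<open>The Beta distribution as a measure\<close>

text \<open>Keeps what the argument uses of the distribution and hides its density. Having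
  \<open>t < 1\<close> almost everywhere makes \<open>1 + z * t\<close> nonzero on the whole closed
  unit disc, even at \<open>z = -1\<close>.\<close>

locale beta_measure =
  fixes M :: "real measure" and \<alpha> :: real
  assumes prob: "prob_space M"
    and sets_M: "sets M = sets borel"
    and AE_M: "AE t in M. 0 \<le> t \<and> t < 1"
    and moment: "\<And>k. (LINT t|M. t ^ k) = beta_moment \<alpha> k"
    and \<alpha>: "0 < \<alpha>" "\<alpha> < 1"

lemma beta_measure_exists:
  assumes "0 < \<alpha>" "\<alpha> < 1"
  shows "\<exists>M. beta_measure M \<alpha>"
proof -
  define f where "f t = indicator {0<..<1} t *
    (t powr (- \<alpha>) * (1 - t) powr (\<alpha> - 1) / Beta (1 - \<alpha>) \<alpha>)" for t
  have [measurable]: "f \<in> borel_measurable borel"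
    unfolding f_def by measurable
  have "Gamma \<alpha> > 0" "Gamma (1 - \<alpha>) > 0"
    using assms by (auto intro!: Gamma_real_pos)
  then have B: "Beta (1 - \<alpha>) \<alpha> > 0"
    by (simp add: Beta_def)
  then have f_nonneg: "0 \<le> f t" for t
    by (simp add: f_def)
  \<comment> \<open>The case \<open>k = 0\<close> also yields total mass one.\<close>
  have nn: "(\<integral>\<^sup>+ t. ennreal (f t * t ^ k) \<partial>lborel) = ennreal (beta_moment \<alpha> k)" for k
    using nn_integral_has_integral_lebesgue[OF _ has_integral_beta_moment[OF assms], of k] B
    by (simp add: f_def mult.assoc)
  define M where "M = density lborel (\<lambda>t. ennreal (f t))"
  have "beta_measure M \<alpha>"
  proof (rule beta_measure.intro)
    show "prob_space M"
      using nn[of 0] by (intro prob_spaceI) (simp add: M_def emeasure_density beta_moment_def)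
    show "sets M = sets borel"
      by (simp add: M_def)
    show "AE t in M. 0 \<le> t \<and> t < 1"
      unfolding M_def by (subst AE_density) (auto simp: f_def indicator_def)
    show "(LINT t|M. t ^ k) = beta_moment \<alpha> k" for k
    proof -
      have "(LINT t|M. t ^ k) = (LINT t|lborel. f t * t ^ k)"
        unfolding M_def by (subst integral_density) (auto simp: f_nonneg)
      also have "\<dots> = enn2real (\<integral>\<^sup>+ t. ennreal (f t * t ^ k) \<partial>lborel)"
        by (rule integral_eq_nn_integral) (auto simp: f_def indicator_def B less_imp_le)
      finally show ?thesis
        using assms by (simp add: nn beta_moment_nonneg)
    qed
  qed (fact assms)+
  then show ?thesis by (rule exI)
qed

section \<open>Partial sums of the binomial series and their integral representation\<close>

text \<open>Agrees with \<open>A_coeff\<close> on the unit circle, but is used on the whole closed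
  disc: the binomial theorem is applied in the interior and carried to the boundary by
  continuity.\<close>

definition binomial_sum :: "real \<Rightarrow> nat \<Rightarrow> complex \<Rightarrow> complex" where
  "binomial_sum \<alpha> m z = (\<Sum>k\<le>m. of_real (\<alpha> gchoose k) * z ^ k)"

lemma A_coeff_eq_binomial_sum: "norm x = 1 \<Longrightarrow> A_coeff m \<alpha> x = binomial_sum \<alpha> m x"
  by (simp add: A_coeff_eq_sum binomial_sum_def gbinomial_pochhammer power_minus[of x]
      mult_ac flip: pochhammer_of_real)

lemma norm_1_plus_mult_ge:
  fixes z :: complex
  assumes "norm z \<le> 1" "0 \<le> t" "t \<le> 1"
  shows "1 - t \<le> norm (1 + z * of_real t)"
proof -
  have "norm (z * of_real t) \<le> t"
    using assms mult_left_le_one_le[of t "norm z"] by (simp add: norm_mult)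
  then show ?thesis
    using norm_diff_ineq[of 1 "z * of_real t"] by simp
qed

context beta_measure
begin

interpretation prob_space M by (rule prob)

lemma measurable_M [simp]: "borel_measurable M = borel_measurable borel"
  by (rule measurable_cong_sets) (simp_all add: sets_M)

text \<open>The sum over all \<open>k\<close> of \<open>z * (1 - t) * (- z * t) ^ k\<close>, for
  \<open>norm z \<le> 1\<close> and \<open>0 \<le> t < 1\<close>.\<close>

definition kernel :: "complex \<Rightarrow> real \<Rightarrow> complex" where
  "kernel z t = z * (1 - of_real t) / (1 + z * of_real t)"

text \<open>An integral form of the power \<open>\<alpha>\<close> of \<open>1 + z\<close> that
  extends to the boundary circle; see \<open>F_eq_powr\<close> and \<open>norm_F\<close>.\<close>

definition F :: "complex \<Rightarrow> complex" where
  "F z = 1 + (LINT t|M. kernel z t)"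

lemma borel_kernel [measurable]: "kernel z \<in> borel_measurable borel"
  unfolding kernel_def by measurable

lemma norm_kernel_le:
  assumes "norm z \<le> 1" "0 \<le> t" "t < 1"
  shows "norm (kernel z t) \<le> 1"
proof -
  have "norm (1 - complex_of_real t) = 1 - t"
    using assms norm_of_real[of "1 - t", where 'a = complex] by simp
  then have "norm (kernel z t) = norm z * (1 - t) / norm (1 + z * of_real t)"
    by (simp add: kernel_def norm_divide norm_mult)
  also have "\<dots> \<le> 1"
  proof -
    have "norm z * (1 - t) \<le> 1 * (1 - t)"
      using assms by (intro mult_right_mono) auto
    also have "\<dots> \<le> norm (1 + z * of_real t)"
      using norm_1_plus_mult_ge[of z t] assms by simp
    finally show ?thesis
      using norm_1_plus_mult_ge[of z t] assms by (subst divide_le_eq_1_pos) linarith+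
  qed
  finally show ?thesis .
qed

lemma integrable_power: "integrable M (\<lambda>t. t ^ k)"
proof (rule integrable_const_bound)
  show "AE t in M. norm (t ^ k) \<le> 1"
    using AE_M by eventually_elim (auto simp: power_le_one)
qed simp

lemma integrable_kernel:
  assumes "norm z \<le> 1"
  shows "integrable M (kernel z)"
proof (rule integrable_const_bound)
  show "AE t in M. norm (kernel z t) \<le> 1"
    using AE_M by eventually_elim (auto simp: norm_kernel_le assms)
qed simp

lemma norm_kernel_mult_power_le:
  assumes "norm z \<le> 1" "0 \<le> t" "t < 1"
  shows "norm (kernel z t * (z * of_real t) ^ m) \<le> t ^ m"
proof -
  have "norm (z * of_real t) ^ m \<le> t ^ m"
    using assms mult_left_le_one_le[of t "norm z"] by (intro power_mono) (auto simp: norm_mult)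
  then show ?thesis
    using norm_kernel_le[OF assms] mult_mono[of "norm (kernel z t)" 1 "norm (z * of_real t) ^ m" "t ^ m"]
    by (simp add: norm_mult norm_power)
qed

lemma integrable_kernel_mult_power:
  assumes "norm z \<le> 1"
  shows "integrable M (\<lambda>t. kernel z t * (z * of_real t) ^ m)"
proof (rule Bochner_Integration.integrable_bound[OF integrable_power[of m]])
  show "AE t in M. norm (kernel z t * (z * of_real t) ^ m) \<le> norm (t ^ m)"
    using AE_M by eventually_elim (use norm_kernel_mult_power_le[OF assms] in auto)
qed simp

lemma integrable_mult_power_kernel:
  assumes "norm z \<le> 1"
  shows "integrable M (\<lambda>t. t ^ m * norm (kernel z t))"
proof (rule Bochner_Integration.integrable_bound[OF integrable_power[of m]])
  show "AE t in M. norm (t ^ m * norm (kernel z t)) \<le> norm (t ^ m)"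
    using AE_M by eventually_elim (use assms in \<open>auto simp: norm_kernel_le mult_left_le\<close>)
qed simp

text \<open>A finite geometric sum with ratio \<open>- z * t\<close> is evaluated under the
  integral. Oddness of \<open>m\<close> gives the remainder its plus sign.\<close>

lemma binomial_sum_eq:
  assumes z: "norm z \<le> 1" and m: "odd m"
  shows "binomial_sum \<alpha> m z = F z + (LINT t|M. kernel z t * (z * of_real t) ^ m)"
proof -
  let ?g = "\<lambda>k t. z ^ Suc k * (- 1) ^ k * of_real (t ^ k - t ^ Suc k)"
  have int: "integrable M (\<lambda>t. complex_of_real (t ^ k - t ^ Suc k))" for k
    by (intro integrable_of_real Bochner_Integration.integrable_diff integrable_power)
  have "binomial_sum \<alpha> m z = 1 + (\<Sum>k<m. of_real (\<alpha> gchoose Suc k) * z ^ Suc k)"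
    by (simp add: binomial_sum_def sum.atMost_shift)
  also have "(\<Sum>k<m. of_real (\<alpha> gchoose Suc k) * z ^ Suc k) = (\<Sum>k<m. LINT t|M. ?g k t)"
  proof (rule sum.cong[OF refl])
    fix k
    have "(LINT t|M. ?g k t) = z ^ Suc k * (- 1) ^ k * of_real (LINT t|M. t ^ k - t ^ Suc k)"
      by (simp only: integral_mult_right_zero integral_complex_of_real)
    also have "(LINT t|M. t ^ k - t ^ Suc k) = beta_moment \<alpha> k - beta_moment \<alpha> (Suc k)"
      by (subst Bochner_Integration.integral_diff[OF integrable_power integrable_power])
        (simp only: moment)
    finally have "(LINT t|M. ?g k t) =
        z ^ Suc k * (- 1) ^ k * of_real (beta_moment \<alpha> k - beta_moment \<alpha> (Suc k))" .
    then show "of_real (\<alpha> gchoose Suc k) * z ^ Suc k = (LINT t|M. ?g k t)"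
      by (simp only: gbinomial_Suc_beta_moment) simp
  qed
  also have "(\<Sum>k<m. LINT t|M. ?g k t) = (LINT t|M. (\<Sum>k<m. ?g k t))"
    by (rule Bochner_Integration.integral_sum[symmetric])
      (intro Bochner_Integration.integrable_mult_right int)
  also have "\<dots> = (LINT t|M. kernel z t + kernel z t * (z * of_real t) ^ m)"
  proof (rule integral_cong_AE)
    show "AE t in M. (\<Sum>k<m. ?g k t) = kernel z t + kernel z t * (z * of_real t) ^ m"
      using AE_M
    proof eventually_elim
      case (elim t)
      let ?q = "- (z * of_real t)"
      have "?q \<noteq> 1"
        using norm_1_plus_mult_ge[OF z, of t] elim by (auto simp: neg_eq_iff_add_eq_0 add.commute)
      have "(\<Sum>k<m. ?g k t) = (\<Sum>k<m. z * (1 - of_real t) * ?q ^ k)"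
        by (intro sum.cong refl) (simp add: power_minus[of "z * of_real t"] power_mult_distrib algebra_simps)
      also have "\<dots> = z * (1 - of_real t) * ((1 - ?q ^ m) / (1 - ?q))"
        using \<open>?q \<noteq> 1\<close> by (simp add: sum_distrib_left[symmetric] sum_gp_strict)
      also have "?q ^ m = - ((z * of_real t) ^ m)"
        using m by simp
      finally show ?case
        by (simp add: kernel_def algebra_simps add_divide_distrib)
    qed
  qed simp_all
  also have "\<dots> = (LINT t|M. kernel z t) + (LINT t|M. kernel z t * (z * of_real t) ^ m)"
    by (intro Bochner_Integration.integral_add integrable_kernel integrable_kernel_mult_power z)
  finally show ?thesis
    by (simp add: F_def)
qed

lemma norm_binomial_sum_diff_le:
  assumes "norm z \<le> 1" "odd m"
  shows "norm (binomial_sum \<alpha> m z - F z) \<le> beta_moment \<alpha> m"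
proof -
  have "norm (LINT t|M. kernel z t * (z * of_real t) ^ m) \<le>
      (LINT t|M. norm (kernel z t * (z * of_real t) ^ m))"
    by (rule integral_norm_bound)
  also have "\<dots> \<le> (LINT t|M. t ^ m)"
  proof (intro integral_mono_AE integrable_norm integrable_power integrable_kernel_mult_power assms)
    show "AE t in M. norm (kernel z t * (z * of_real t) ^ m) \<le> t ^ m"
      using AE_M by eventually_elim (use norm_kernel_mult_power_le[OF assms(1)] in auto)
  qed
  finally have "norm (LINT t|M. kernel z t * (z * of_real t) ^ m) \<le> (LINT t|M. t ^ m)" .
  then show ?thesis
    using assms by (simp add: binomial_sum_eq moment)
qed

text \<open>No mass sits at \<open>t = 1\<close>, so the powers tend to zero almost everywhere,
  dominated by \<open>1\<close>.\<close>

lemma beta_moment_tendsto_0: "beta_moment \<alpha> \<longlonglongrightarrow> 0"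
proof -
  have "(\<lambda>k. LINT t|M. t ^ k) \<longlonglongrightarrow> (LINT t|M. 0)"
  proof (rule integral_dominated_convergence[where w = "\<lambda>_. 1"])
    show "AE t in M. (\<lambda>k. t ^ k) \<longlonglongrightarrow> 0"
      using AE_M by eventually_elim (auto intro!: LIMSEQ_power_zero)
    show "AE t in M. norm (t ^ k) \<le> 1" for k
      using AE_M by eventually_elim (auto simp: power_le_one)
  qed auto
  then show ?thesis
    by (simp add: moment)
qed

text \<open>The error bound \<open>beta_moment \<alpha> m\<close> does not depend on
  \<open>z\<close>. Uniformity up to the boundary makes \<open>F\<close> continuous there.\<close>

lemma uniform_limit_binomial_sum:
  "uniform_limit (cball 0 1) (\<lambda>n. binomial_sum \<alpha> (2 * n + 1)) F sequentially"
proof (rule uniform_limitI)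
  fix e :: real
  assume "e > 0"
  have "filterlim (\<lambda>n. 2 * n + 1) at_top (sequentially :: nat filter)"
    by (rule filterlim_subseq) (auto simp: strict_mono_def)
  with beta_moment_tendsto_0 have "(\<lambda>n. beta_moment \<alpha> (2 * n + 1)) \<longlonglongrightarrow> 0"
    by (rule filterlim_compose)
  then have "\<forall>\<^sub>F n in sequentially. beta_moment \<alpha> (2 * n + 1) < e"
    using \<open>e > 0\<close> by (rule order_tendstoD)
  then show "\<forall>\<^sub>F n in sequentially. \<forall>z\<in>cball 0 1. dist (binomial_sum \<alpha> (2 * n + 1) z) (F z) < e"
  proof eventually_elim
    case (elim n)
    then show ?case
      using norm_binomial_sum_diff_le[of _ "2 * n + 1"]
      by (fastforce simp: dist_norm intro: le_less_trans)
  qed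
qed

lemma continuous_on_F: "continuous_on (cball 0 1) F"
proof (rule uniform_limit_theorem[OF _ uniform_limit_binomial_sum])
  show "\<forall>\<^sub>F n in sequentially. continuous_on (cball 0 1) (binomial_sum \<alpha> (2 * n + 1))"
    unfolding binomial_sum_def by (intro always_eventually allI continuous_intros)
qed simp

text \<open>Both sides are the limit of the partial sums of odd index, the right one by the binomial
  theorem.\<close>

lemma F_eq_powr:
  assumes "norm z < 1"
  shows "F z = (1 + z) powr of_real \<alpha>"
proof -
  have *: "(\<lambda>n. binomial_sum \<alpha> (2 * n + 1) z) \<longlonglongrightarrow> F z"
    using assms by (intro tendsto_uniform_limitI[OF uniform_limit_binomial_sum]) auto
  have "(\<lambda>n. binomial_sum \<alpha> n z) \<longlonglongrightarrow> (1 + z) powr of_real \<alpha>"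
    using gen_binomial_complex[OF assms, of "of_real \<alpha>"]
    unfolding sums_def_le binomial_sum_def by (simp add: gbinomial_pochhammer flip: pochhammer_of_real)
  moreover have "filterlim (\<lambda>n. 2 * n + 1) at_top (sequentially :: nat filter)"
    by (rule filterlim_subseq) (auto simp: strict_mono_def)
  ultimately have "(\<lambda>n. binomial_sum \<alpha> (2 * n + 1) z) \<longlonglongrightarrow> (1 + z) powr of_real \<alpha>"
    by (rule filterlim_compose)
  with * show ?thesis
    by (rule LIMSEQ_unique)
qed

text \<open>Both sides are continuous on the closed disc and agree inside. Passing to moduli avoids
  continuity of the complex power at \<open>0\<close>; the real power is continuous there because
  \<open>0 < \<alpha>\<close>.\<close>

lemma norm_F:
  assumes "norm z \<le> 1"
  shows "norm (F z) = norm (1 + z) powr \<alpha>"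
proof -
  have "norm (F z) - norm (1 + z) powr \<alpha> = 0"
  proof (rule continuous_constant_on_closure[where S = "ball 0 1" and
        f = "\<lambda>z. norm (F z) - norm (1 + z) powr \<alpha>"])
    show "continuous_on (closure (ball 0 1)) (\<lambda>z. norm (F z) - norm (1 + z) powr \<alpha>)"
      using \<alpha> continuous_on_F
      by (intro continuous_on_diff continuous_on_norm continuous_on_powr' continuous_intros) auto
    show "norm (F w) - norm (1 + w) powr \<alpha> = 0" if "w \<in> ball 0 1" for w
      using that by (auto simp: F_eq_powr norm_powr_real_powr')
    show "z \<in> closure (ball 0 1)"
      using assms by simp
  qed
  then show ?thesis by simp
qed

lemma kernel_of_real: "kernel (of_real s) t = of_real (s * (1 - t) / (1 + s * t))"
  by (simp add: kernel_def)

lemma F_of_real: "F (of_real s) = of_real (1 + (LINT t|M. s * (1 - t) / (1 + s * t)))"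
  unfolding F_def kernel_of_real integral_complex_of_real by simp

text \<open>Applied with \<open>s = 1\<close> and \<open>s = u - 1\<close> to write the powers of
  \<open>2\<close> and \<open>u\<close> as integrals. The endpoint \<open>s = 1\<close> lies on the
  circle, so its value comes from \<open>norm_F\<close> and the sign of the integrand.\<close>

lemma F_of_real_eq_powr:
  assumes "- 1 < s" "s \<le> 1"
  shows "1 + (LINT t|M. s * (1 - t) / (1 + s * t)) = (1 + s) powr \<alpha>"
proof (cases "s < 1")
  case True
  then have "F (of_real s) = (1 + of_real s) powr of_real \<alpha>"
    using assms by (intro F_eq_powr) simp
  also have "\<dots> = of_real ((1 + s) powr \<alpha>)"
    using assms powr_of_real[of "1 + s" \<alpha>] by simp
  finally show ?thesis
    unfolding F_of_real of_real_eq_iff .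
next
  case False
  then have "s = 1"
    using assms by simp
  have "AE t in M. 0 \<le> s * (1 - t) / (1 + s * t)"
    using AE_M by eventually_elim (simp add: \<open>s = 1\<close>)
  then have "0 \<le> (LINT t|M. s * (1 - t) / (1 + s * t))"
    by (rule integral_nonneg_AE)
  then show ?thesis
    using norm_F[of "of_real s"] unfolding F_of_real norm_of_real by (simp add: \<open>s = 1\<close>)
qed

lemma integrable_real_kernel:
  assumes "\<bar>s\<bar> \<le> 1"
  shows "integrable M (\<lambda>t. s * (1 - t) / (1 + s * t))"
  using integrable_Re[OF integrable_kernel[of "of_real s"]] assms
  unfolding kernel_of_real Re_complex_of_real by simp

section \<open>Bounds for the partial sums of odd index\<close>

lemma norm_binomial_sum_le:
  assumes "norm z \<le> 1" "odd m"
  shows "norm (binomial_sum \<alpha> m z) \<le> norm (1 + z) powr \<alpha> + (LINT t|M. t ^ m * norm (kernel z t))"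
proof -
  have "norm (LINT t|M. kernel z t * (z * of_real t) ^ m)
      \<le> (LINT t|M. norm (kernel z t * (z * of_real t) ^ m))"
    by (rule integral_norm_bound)
  also have "\<dots> \<le> (LINT t|M. t ^ m * norm (kernel z t))"
  proof (intro integral_mono_AE integrable_norm integrable_kernel_mult_power
      integrable_mult_power_kernel assms)
    show "AE t in M. norm (kernel z t * (z * of_real t) ^ m) \<le> t ^ m * norm (kernel z t)"
      using AE_M
    proof eventually_elim
      case (elim t)
      have "norm (z * of_real t) ^ m \<le> t ^ m"
        using elim assms mult_left_le_one_le[of t "norm z"]
        by (intro power_mono) (auto simp: norm_mult)
      then show ?case
        unfolding norm_mult[of "kernel z t"] norm_power
        by (subst mult.commute) (rule mult_right_mono, auto)
    qed
  qed
  finally have "norm (LINT t|M. kernel z t * (z * of_real t) ^ m)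
      \<le> (LINT t|M. t ^ m * norm (kernel z t))" .
  then show ?thesis
    using norm_triangle_ineq[of "F z" "LINT t|M. kernel z t * (z * of_real t) ^ m"] assms
    by (simp add: binomial_sum_eq norm_F)
qed

text \<open>At \<open>z = 1\<close> the kernel is nonnegative on the support, so the bound of
  \<open>norm_binomial_sum_le\<close> is attained.\<close>

lemma Re_binomial_sum_1:
  assumes "odd m"
  shows "Re (binomial_sum \<alpha> m 1) = 2 powr \<alpha> + (LINT t|M. t ^ m * ((1 - t) / (1 + t)))"
proof -
  have "kernel 1 t * (1 * of_real t) ^ m = of_real (t ^ m * ((1 - t) / (1 + t)))" for t
    using kernel_of_real[of 1 t] by simp
  then have "(LINT t|M. kernel 1 t * (1 * of_real t) ^ m) = of_real (LINT t|M. t ^ m * ((1 - t) / (1 + t)))"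
    by (simp only: integral_complex_of_real)
  moreover have "F (of_real 1) = of_real ((1 + 1) powr \<alpha>)"
    by (subst F_of_real, subst F_of_real_eq_powr) auto
  ultimately show ?thesis
    using binomial_sum_eq[of 1 m] assms by simp
qed

text \<open>With both powers written as integrals, the claim follows by integrating
  \<open>integrand_bound\<close> over \<open>M\<close>.\<close>

lemma norm_binomial_sum_le_far:
  assumes x: "norm x = 1" and m: "odd m" "3 \<le> m" and u: "1 / 3 \<le> norm (1 + x)"
  shows "norm (binomial_sum \<alpha> m x) \<le> Re (binomial_sum \<alpha> m 1)"
proof -
  define u where "u = norm (1 + x)"
  have u_bounds: "1 / 3 \<le> u" "u \<le> 2"
    using norm_triangle_ineq[of 1 x] x u by (auto simp: u_def)
  let ?h = "\<lambda>t. (u - 1) * (1 - t) / (1 + (u - 1) * t)"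
  let ?p = "\<lambda>t. (1 - t) / (1 + t)"
  have int_p: "integrable M ?p"
    using integrable_real_kernel[of 1] by simp
  have int_mp: "integrable M (\<lambda>t. t ^ m * ?p t)"
  proof (rule Bochner_Integration.integrable_bound[OF int_p])
    show "AE t in M. norm (t ^ m * ?p t) \<le> norm (?p t)"
      using AE_M
    proof eventually_elim
      case (elim t)
      then show ?case
        using mult_left_le_one_le[of "?p t" "t ^ m"] by (simp add: power_le_one)
    qed
  qed simp
  have int_h: "integrable M ?h"
    using integrable_real_kernel[of "u - 1"] u_bounds by simp
  have int_k: "integrable M (\<lambda>t. t ^ m * norm (kernel x t))"
    using x by (intro integrable_mult_power_kernel) simp
  have h: "1 + (LINT t|M. ?h t) = u powr \<alpha>"
    using F_of_real_eq_powr[of "u - 1"] u_bounds by simp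
  have p: "1 + (LINT t|M. ?p t) = 2 powr \<alpha>"
    using F_of_real_eq_powr[of 1] by simp
  have "(LINT t|M. ?h t + t ^ m * norm (kernel x t)) \<le> (LINT t|M. ?p t + t ^ m * ?p t)"
  proof (intro integral_mono_AE Bochner_Integration.integrable_add int_h int_k int_p int_mp)
    show "AE t in M. ?h t + t ^ m * norm (kernel x t) \<le> ?p t + t ^ m * ?p t"
      using AE_M
    proof eventually_elim
      case (elim t)
      define d where "d = norm (1 + x * of_real t)"
      have "norm (1 - complex_of_real t) = 1 - t"
        using elim norm_of_real[of "1 - t", where 'a = complex] by simp
      then have "norm (kernel x t) = (1 - t) / d"
        using x by (simp add: kernel_def norm_divide norm_mult d_def)
      moreover have "0 < d"
        using norm_1_plus_mult_ge[of x t] x elim unfolding d_def by linarith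
      moreover have "d ^ 2 = (1 - t) ^ 2 + t * u ^ 2"
        unfolding d_def u_def by (rule norm_1_plus_mult_unit[OF x])
      ultimately show ?case
        using integrand_bound[of t u d m] elim u_bounds m by simp
    qed
  qed
  then have "(LINT t|M. ?h t) + (LINT t|M. t ^ m * norm (kernel x t))
      \<le> (LINT t|M. ?p t) + (LINT t|M. t ^ m * ?p t)"
    by (simp only: Bochner_Integration.integral_add int_h int_k int_p int_mp)
  moreover have "norm (binomial_sum \<alpha> m x) \<le> u powr \<alpha> + (LINT t|M. t ^ m * norm (kernel x t))"
    unfolding u_def using x m by (intro norm_binomial_sum_le) auto
  ultimately show ?thesis
    using h p Re_binomial_sum_1[OF m(1)] by linarith
qed

text \<open>Crude constants suffice: \<open>7 / 10\<close> bounds the main term,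
  \<open>11 / 20\<close> the remainder, and their sum \<open>5 / 4\<close> is at most
  \<open>2 powr \<alpha>\<close>.\<close>

lemma norm_binomial_sum_le_near:
  assumes x: "norm x = 1" and m: "odd m" "3 \<le> m" and u: "norm (1 + x) \<le> 1 / 3"
    and \<alpha>_ge: "1 / 3 \<le> \<alpha>"
  shows "norm (binomial_sum \<alpha> m x) \<le> Re (binomial_sum \<alpha> m 1)"
proof -
  \<comment> \<open>The cube of \<open>7 / 10\<close> is \<open>0.343\<close>, just above
    \<open>1 / 3\<close>; for a base below one the power is largest at
    \<open>\<alpha> = 1 / 3\<close>.\<close>
  have "norm (1 + x) powr \<alpha> \<le> ((7 / 10) ^ 3) powr \<alpha>"
    using u \<alpha> by (intro powr_mono2) (auto simp: power3_eq_cube)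
  also have "\<dots> \<le> ((7 / 10) ^ 3) powr (1 / 3)"
    using \<alpha>_ge by (intro powr_mono') (auto simp: power3_eq_cube)
  also have "\<dots> = 7 / 10"
    using powr_powr[of "7 / 10" 3 "1 / 3"] by simp
  finally have 1: "norm (1 + x) powr \<alpha> \<le> 7 / 10" .
  \<comment> \<open>The cube of \<open>5 / 4\<close> is \<open>125 / 64\<close>, just below
    \<open>2\<close>.\<close>
  have "5 / 4 = ((5 / 4) ^ 3) powr (1 / 3 :: real)"
    using powr_powr[of "5 / 4" 3 "1 / 3"] by simp
  also have "\<dots> \<le> 2 powr (1 / 3)"
    by (intro powr_mono2) (auto simp: power3_eq_cube)
  also have "\<dots> \<le> 2 powr \<alpha>"
    using \<alpha>_ge by (intro powr_mono) auto
  finally have 2: "5 / 4 \<le> 2 powr \<alpha>" .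
  have "beta_moment \<alpha> m = (LINT t|M. t ^ m)"
    by (simp add: moment)
  also have "\<dots> \<le> (LINT t|M. t ^ 3)"
  proof (intro integral_mono_AE integrable_power)
    show "AE t in M. t ^ m \<le> t ^ 3"
      using AE_M by eventually_elim (use m in \<open>auto intro: power_decreasing\<close>)
  qed
  also have "\<dots> = (1 - \<alpha>) * (2 - \<alpha>) * (3 - \<alpha>) / 6"
    unfolding moment beta_moment_def by (simp add: pochhammer_Suc eval_nat_numeral)
  \<comment> \<open>Each factor decreases in \<open>\<alpha>\<close>; at
    \<open>\<alpha> = 1 / 3\<close> the third moment is \<open>40 / 81\<close>, below
    \<open>11 / 20\<close>.\<close>
  also have "(1 - \<alpha>) * (2 - \<alpha>) * (3 - \<alpha>) \<le> (2 / 3) * (5 / 3) * (8 / 3)"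
    using \<alpha>_ge \<alpha> by (intro mult_mono) auto
  finally have 3: "beta_moment \<alpha> m \<le> 11 / 20"
    by simp
  have "norm (binomial_sum \<alpha> m x) \<le> norm (F x) + norm (binomial_sum \<alpha> m x - F x)"
    using norm_triangle_ineq[of "F x" "binomial_sum \<alpha> m x - F x"] by simp
  also have "\<dots> \<le> norm (1 + x) powr \<alpha> + beta_moment \<alpha> m"
    using x m norm_binomial_sum_diff_le[of x m] norm_F[of x] by simp
  also have "\<dots> \<le> 2 powr \<alpha>"
    using 1 2 3 by simp
  also have "0 \<le> (LINT t|M. t ^ m * ((1 - t) / (1 + t)))"
    by (rule integral_nonneg_AE) (use AE_M in eventually_elim, auto)
  then have "2 powr \<alpha> \<le> Re (binomial_sum \<alpha> m 1)"
    using Re_binomial_sum_1[OF m(1)] by simp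
  finally show ?thesis .
qed

end

theorem corollary2:
  fixes \<alpha> :: real and x :: complex and n :: nat
  assumes "1 / 3 \<le> \<alpha>" and "\<alpha> < 1"
    and "norm x = 1"
    and "n \<ge> 1"
  shows "norm (A_coeff (2 * n - 1) \<alpha> x) \<le> Re (A_coeff (2 * n - 1) \<alpha> 1)"
proof (cases "n = 1")
  case True
  \<comment> \<open>The coefficient is \<open>1 + \<alpha> * x\<close>, treated directly because the
    general estimates require \<open>3 \<le> m\<close>.\<close>
  have "norm (1 + of_real \<alpha> * x) \<le> 1 + \<alpha>"
    using norm_triangle_ineq[of 1 "of_real \<alpha> * x"] assms by (simp add: norm_mult)
  then show ?thesis
    using True assms by (simp add: A_coeff_eq_binomial_sum binomial_sum_def)
next
  case False
  obtain M where "beta_measure M \<alpha>"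
    using beta_measure_exists[of \<alpha>] assms by auto
  then interpret beta_measure M \<alpha> .
  have "odd (2 * n - 1)" "3 \<le> 2 * n - 1"
    using False assms by auto
  then show ?thesis
    using norm_binomial_sum_le_far[of x "2 * n - 1"] norm_binomial_sum_le_near[of x "2 * n - 1"] assms
    by (simp add: A_coeff_eq_binomial_sum) linarith
qed

end
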